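(* Let $R$ be a $\mathbb{Q}$-domain, $n=2$, and $D\in\mathrm{LND}_R R[x_1,x_2]$. If $\exp fD\in\mathrm{T}(R,\mathbf{x})$ for some $f\in\ker D\setminus\{0\}$, then $\exp D\in\mathrm{T}(R,\mathbf{x})$.
   Context: $\mathrm{LND}_R R[\mathbf{x}]$ is the set of locally nilpotent $R$-derivations; $\exp D(f)=\sum_{l\ge0}D^l(f)/l!$. $\mathrm{T}(R,\mathbf{x})$ is the subgroup of $\mathrm{Aut}(R[\mathbf{x}]/R)$ generated by affine automorphisms ($\deg\phi(x_i)=1$ for all $i$) and elementary automorphisms (fixing all variables but one). *)

theory Defs
  imports "HOL-Computational_Algebra.Polynomial"
begin

text \<open>The bivariate polynomial ring R[x1,x2] is represented as 'a poly poly: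
  the inner variable is x1, the outer variable is x2.\<close>

definition X1 :: "'a::comm_ring_1 poly poly" where "X1 = [:[:0, 1:]:]"
definition X2 :: "'a::comm_ring_1 poly poly" where "X2 = [:0, 1:]"

definition cnst :: "'a::comm_ring_1 \<Rightarrow> 'a poly poly" where "cnst a = [:[:a:]:]"

definition eval2 :: "'a::comm_ring_1 poly poly \<Rightarrow> 'a poly poly \<Rightarrow> 'a poly poly \<Rightarrow> 'a poly poly" where
  "eval2 u v p = poly (map_poly (\<lambda>q. poly (map_poly cnst q) u) p) v"

text \<open>Total degree (meaningful for nonzero p).\<close>
definition totdeg :: "'a::comm_ring_1 poly poly \<Rightarrow> nat" where
  "totdeg p = Max {i + j | i j. coeff (coeff p j) i \<noteq> 0}"

definition R_derivation :: "('a::comm_ring_1 poly poly \<Rightarrow> 'a poly poly) \<Rightarrow> bool" where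
  "R_derivation D \<longleftrightarrow> (\<forall>p q. D (p + q) = D p + D q) \<and> (\<forall>p q. D (p * q) = p * D q + q * D p)
      \<and> (\<forall>a. D (cnst a) = 0)"

definition is_LND :: "('a::comm_ring_1 poly poly \<Rightarrow> 'a poly poly) \<Rightarrow> bool" where
  "is_LND D \<longleftrightarrow> R_derivation D \<and> (\<forall>p. \<exists>m. (D ^^ m) p = 0)"

text \<open>Inverse of a unit of R (here used for 1/l!, which exists in a Q-domain).\<close>
definition unit_inv :: "'a::comm_ring_1 \<Rightarrow> 'a" where "unit_inv u = (THE v. u * v = 1)"

definition lnd_exp :: "('a::comm_ring_1 poly poly \<Rightarrow> 'a poly poly) \<Rightarrow> 'a poly poly \<Rightarrow> 'a poly poly" where
  "lnd_exp D p = (\<Sum>l < (LEAST m. (D ^^ m) p = 0). cnst (unit_inv (of_nat (fact l))) * (D ^^ l) p)"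

definition R_aut :: "('a::comm_ring_1 poly poly \<Rightarrow> 'a poly poly) \<Rightarrow> bool" where
  "R_aut \<phi> \<longleftrightarrow> bij \<phi> \<and> \<phi> = eval2 (\<phi> X1) (\<phi> X2)"

definition affine_aut :: "('a::comm_ring_1 poly poly \<Rightarrow> 'a poly poly) \<Rightarrow> bool" where
  "affine_aut \<phi> \<longleftrightarrow> R_aut \<phi> \<and> \<phi> X1 \<noteq> 0 \<and> totdeg (\<phi> X1) = 1 \<and> \<phi> X2 \<noteq> 0 \<and> totdeg (\<phi> X2) = 1"

definition elementary_aut :: "('a::comm_ring_1 poly poly \<Rightarrow> 'a poly poly) \<Rightarrow> bool" where
  "elementary_aut \<phi> \<longleftrightarrow> R_aut \<phi> \<and> (\<phi> X1 = X1 \<or> \<phi> X2 = X2)"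

inductive_set tame :: "('a::comm_ring_1 poly poly \<Rightarrow> 'a poly poly) set" where
  gen: "affine_aut \<phi> \<or> elementary_aut \<phi> \<Longrightarrow> \<phi> \<in> tame"
| comp: "\<phi> \<in> tame \<Longrightarrow> \<psi> \<in> tame \<Longrightarrow> \<phi> \<circ> \<psi> \<in> tame"
| inverse: "\<phi> \<in> tame \<Longrightarrow> inv \<phi> \<in> tame"

end

theory Submission
  imports Defs
begin

text \<open>A tame automorphism is a word in affine and triangular automorphisms. Conjugating \<open>D\<close> and \<open>f\<close>
  along with \<open>F = exp (f D)\<close> and merging letters of the same kind, also cyclically, one arrives at
  a single letter or at an alternating word of even length. The second case is impossible: each
  triangular letter that is not affine at least doubles the degree, so the degrees of the iterates
  of \<open>F\<close> would be unbounded, whereas a given polynomial generates a finitely generated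
  \<open>f D\<close>-stable \<open>R\<close>-module, which \<open>F\<close> preserves. In the first case \<open>F\<close> preserves the span of \<open>1, x1, x2\<close> or
  that of \<open>1, x1\<close>. Taking logarithms, so does \<open>f D\<close>; dividing by \<open>f\<close>, so does \<open>D\<close>, and hence
  \<open>exp D\<close> is affine or triangular.\<close>

section \<open>Endomorphisms of the bivariate polynomial ring\<close>

text \<open>Algebraic form of the condition \<open>\<phi> = eval2 (\<phi> X1) (\<phi> X2)\<close>.
  These laws are easy to check for compositions, inverses and exponentials.\<close>

definition R_hom :: "('a::comm_ring_1 poly poly \<Rightarrow> 'a poly poly) \<Rightarrow> bool" where
  "R_hom \<phi> \<longleftrightarrow> (\<forall>p q. \<phi> (p + q) = \<phi> p + \<phi> q) \<and> (\<forall>p q. \<phi> (p * q) = \<phi> p * \<phi> q)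
      \<and> (\<forall>a. \<phi> (cnst a) = cnst a)"

lemma cnst_simps [simp]: "cnst 0 = 0" "cnst 1 = 1" "cnst (a + b) = cnst a + cnst b"
  "cnst (a * b) = cnst a * cnst b" "cnst (- a) = - cnst a" "cnst (a - b) = cnst a - cnst b"
  "cnst a = 0 \<longleftrightarrow> a = 0"
  by (auto simp: cnst_def one_pCons)

lemma pCons_pCons_eq: "[:pCons a q:] = cnst a + X1 * [:q:]"
  by (simp add: cnst_def X1_def)

lemma pCons_eq_X2: "pCons q p = [:q:] + X2 * p"
  by (simp add: X2_def)

lemma eval2_pCons: "eval2 u v (pCons q p) = eval2 u v [:q:] + v * eval2 u v p"
  by (simp add: eval2_def map_poly_pCons)

lemma eval2_0 [simp]: "eval2 u v 0 = 0"
  by (simp add: eval2_def)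

lemma eval2_inner_pCons: "eval2 u v [:pCons a q:] = cnst a + u * eval2 u v [:q:]"
  by (simp add: eval2_def map_poly_pCons)

lemma eval2_inner_add: "eval2 u v [:q + r:] = eval2 u v [:q:] + eval2 u v [:r:]"
  by (induction q r rule: poly_induct2) (simp_all add: eval2_inner_pCons algebra_simps)

lemma eval2_add: "eval2 u v (p + q) = eval2 u v p + eval2 u v q"
proof (induction p q rule: poly_induct2)
  case (pCons a p b q)
  then show ?case
    by (simp add: eval2_pCons[of u v _ p] eval2_pCons[of u v _ q] eval2_pCons[of u v _ "p + q"]
        eval2_inner_add algebra_simps)
qed simp

lemma eval2_inner_smult: "eval2 u v [:smult a q:] = cnst a * eval2 u v [:q:]"
  by (induction q) (simp_all add: eval2_inner_pCons algebra_simps)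

lemma eval2_inner_mult: "eval2 u v [:q * r:] = eval2 u v [:q:] * eval2 u v [:r:]"
  by (induction q)
    (simp_all add: eval2_inner_pCons eval2_inner_add eval2_inner_smult algebra_simps)

lemma eval2_smult: "eval2 u v (smult c p) = eval2 u v [:c:] * eval2 u v p"
proof (induction p)
  case (pCons a p)
  then show ?case
    by (simp add: eval2_pCons[of u v _ p] eval2_pCons[of u v _ "smult c p"]
        eval2_inner_mult algebra_simps)
qed simp

lemma eval2_mult: "eval2 u v (p * q) = eval2 u v p * eval2 u v q"
proof (induction p)
  case (pCons a p)
  then show ?case
    by (simp add: eval2_pCons[of u v _ p] eval2_pCons[of u v 0 "p * q"] eval2_add eval2_smult
        algebra_simps)
qed simp

lemma eval2_cnst: "eval2 u v (cnst a) = cnst a"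
  by (simp add: cnst_def[of a] eval2_inner_pCons)

lemma eval2_X1 [simp]: "eval2 u v X1 = u"
  by (simp add: X1_def eval2_inner_pCons)

lemma eval2_X2 [simp]: "eval2 u v X2 = v"
proof -
  have "eval2 u v [:1:] = 1" using eval2_cnst[of u v 1] by (simp add: one_pCons cnst_def)
  then show ?thesis by (simp add: X2_def eval2_pCons[of u v 0])
qed

lemma R_hom_eval2: "R_hom (eval2 u v)"
  by (simp add: R_hom_def eval2_add eval2_mult eval2_cnst)

lemma R_hom_simps:
  assumes "R_hom \<phi>"
  shows "\<phi> (p + q) = \<phi> p + \<phi> q" "\<phi> (p * q) = \<phi> p * \<phi> q" "\<phi> (cnst a) = cnst a"
    "\<phi> 0 = 0" "\<phi> 1 = 1" "\<phi> (- p) = - \<phi> p" "\<phi> (p - q) = \<phi> p - \<phi> q"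
proof -
  show a: "\<phi> (p + q) = \<phi> p + \<phi> q" for p q using assms by (simp add: R_hom_def)
  show m: "\<phi> (p * q) = \<phi> p * \<phi> q" for p q using assms by (simp add: R_hom_def)
  show c: "\<phi> (cnst a) = cnst a" for a using assms by (simp add: R_hom_def)
  show z: "\<phi> 0 = 0" using c[of 0] by simp
  show "\<phi> 1 = 1" using c[of 1] by simp
  show n: "\<phi> (- p) = - \<phi> p" for p using a[of p "- p"] z by (simp add: minus_unique)
  show "\<phi> (p - q) = \<phi> p - \<phi> q" using a[of p "- q"] n[of q] by simp
qed

text \<open>Every polynomial arises from \<open>cnst\<close>, \<open>X1\<close> and
  \<open>X2\<close> by sums and products. The induction runs first over polynomials in x1 alone,
  then over the powers of x2.\<close>

lemma R_hom_eq_eval2: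
  assumes "R_hom \<phi>" shows "\<phi> = eval2 (\<phi> X1) (\<phi> X2)"
proof
  note h = R_hom_simps[OF assms]
  have inner: "\<phi> [:q:] = eval2 (\<phi> X1) (\<phi> X2) [:q:]" for q
  proof (induction q)
    case (pCons a q)
    then show ?case
      by (simp only: eval2_inner_pCons) (simp only: pCons_pCons_eq h)
  qed (simp add: h)
  show "\<phi> p = eval2 (\<phi> X1) (\<phi> X2) p" for p
  proof (induction p)
    case (pCons q p)
    then show ?case
      by (simp only: eval2_pCons[of _ _ q p] inner[symmetric]) (simp only: pCons_eq_X2[of q p] h)
  qed (simp add: h)
qed

lemma R_hom_eqI:
  "R_hom \<phi> \<Longrightarrow> R_hom \<psi> \<Longrightarrow> \<phi> X1 = \<psi> X1 \<Longrightarrow> \<phi> X2 = \<psi> X2 \<Longrightarrow> \<phi> = \<psi>"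
  by (metis R_hom_eq_eval2)

lemma R_aut_iff: "R_aut \<phi> \<longleftrightarrow> bij \<phi> \<and> R_hom \<phi>"
  unfolding R_aut_def by (metis R_hom_eq_eval2 R_hom_eval2)

lemma R_hom_id: "R_hom id"
  by (simp add: R_hom_def)

lemma R_hom_comp: "R_hom \<phi> \<Longrightarrow> R_hom \<psi> \<Longrightarrow> R_hom (\<phi> \<circ> \<psi>)"
  by (simp add: R_hom_def)

lemma R_aut_id: "R_aut id"
  by (simp add: R_aut_iff R_hom_id)

lemma R_aut_comp: "R_aut \<phi> \<Longrightarrow> R_aut \<psi> \<Longrightarrow> R_aut (\<phi> \<circ> \<psi>)"
  by (auto simp: R_aut_iff R_hom_comp bij_comp)

lemma R_aut_hom: "R_aut \<phi> \<Longrightarrow> R_hom \<phi>"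
  by (simp add: R_aut_iff)

lemma R_aut_inv_cancel:
  assumes "R_aut \<phi>" shows "\<phi> (inv \<phi> p) = p" "inv \<phi> (\<phi> p) = p"
    "\<phi> \<circ> inv \<phi> = id" "inv \<phi> \<circ> \<phi> = id"
  using assms by (auto simp: R_aut_iff bij_is_inj bij_is_surj surj_f_inv_f fun_eq_iff)

lemma R_aut_inv:
  assumes "R_aut \<phi>" shows "R_aut (inv \<phi>)"
proof -
  note h = R_hom_simps[OF R_aut_hom[OF assms]]
  have "inj \<phi>" using assms by (simp add: R_aut_iff bij_is_inj)
  then have inv_eq: "inv \<phi> p = q" if "\<phi> q = p" for p q
    using that by (metis inv_f_f)
  then have "R_hom (inv \<phi>)"
    unfolding R_hom_def by (auto intro!: inv_eq simp: h R_aut_inv_cancel(1)[OF assms])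
  with assms show ?thesis by (simp add: R_aut_iff bij_imp_bij_inv)
qed

lemma R_aut_eq_0_iff: "R_aut \<phi> \<Longrightarrow> \<phi> p = 0 \<longleftrightarrow> p = 0"
  by (metis R_aut_inv_cancel(2) R_aut_inv R_aut_hom R_hom_simps(4))

lemma R_autI_inverse:
  assumes "R_hom \<phi>" "R_hom \<psi>" "\<phi> \<circ> \<psi> = id" "\<psi> \<circ> \<phi> = id" shows "R_aut \<phi>"
  using assms by (simp add: R_aut_iff o_bij)

section \<open>Exponentials of locally nilpotent derivations\<close>

lemma derivation_simps:
  assumes "R_derivation D"
  shows "D (p + q) = D p + D q" "D (p * q) = p * D q + q * D p" "D (cnst a) = 0"
    "D 0 = 0" "D (- p) = - D p" "D (p - q) = D p - D q" "D (cnst a * p) = cnst a * D p"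
    "D (sum g S) = (\<Sum>i\<in>S. D (g i))"
proof -
  show a: "D (p + q) = D p + D q" for p q using assms by (simp add: R_derivation_def)
  show m: "D (p * q) = p * D q + q * D p" for p q using assms by (simp add: R_derivation_def)
  show c: "D (cnst a) = 0" for a using assms by (simp add: R_derivation_def)
  show z: "D 0 = 0" using c[of 0] by simp
  show n: "D (- p) = - D p" for p using a[of p "- p"] z by (simp add: minus_unique)
  show "D (p - q) = D p - D q" using a[of p "- q"] n[of q] by simp
  show "D (cnst a * p) = cnst a * D p" by (simp add: m c)
  show "D (sum g S) = (\<Sum>i\<in>S. D (g i))"
    by (induction S rule: infinite_finite_induct) (simp_all add: a z)
qed

lemma derivation_iterate_simps:
  assumes "R_derivation D"
  shows "(D ^^ n) (p + q) = (D ^^ n) p + (D ^^ n) q" "(D ^^ n) 0 = 0"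
    "(D ^^ n) (p - q) = (D ^^ n) p - (D ^^ n) q" "(D ^^ n) (cnst a * p) = cnst a * (D ^^ n) p"
    "(D ^^ n) (sum g S) = (\<Sum>i\<in>S. (D ^^ n) (g i))" "(D ^^ n) (- p) = - (D ^^ n) p"
  by (induction n) (simp_all add: derivation_simps[OF assms])

lemma iterate_vanish:
  assumes "R_derivation D" "(D ^^ m) p = 0" "m \<le> n" shows "(D ^^ n) p = 0"
proof -
  have "(D ^^ n) p = (D ^^ (n - m)) ((D ^^ m) p)"
    using assms(3) by (metis add.commute comp_apply funpow_add le_add_diff_inverse)
  then show ?thesis by (simp add: assms(2) derivation_iterate_simps[OF assms(1)])
qed

lemma cnst_of_nat: "cnst (of_nat n) = of_nat n"
  by (induction n) simp_all

lemma derivation_of_nat_mult: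
  "R_derivation D \<Longrightarrow> D (of_nat n * p) = of_nat n * D p"
  by (metis cnst_of_nat derivation_simps(7))

lemma Leibniz:
  assumes "R_derivation D"
  shows "(D ^^ n) (p * q) = (\<Sum>k\<le>n. of_nat (n choose k) * ((D ^^ k) p * (D ^^ (n - k)) q))"
proof (induction n)
  case (Suc n)
  let ?a = "\<lambda>k. (D ^^ k) p" and ?b = "\<lambda>k. (D ^^ k) q"
  have "(D ^^ Suc n) (p * q) = (\<Sum>k\<le>n. of_nat (n choose k) * (?a k * ?b (Suc n - k)))
      + (\<Sum>k\<le>n. of_nat (n choose k) * (?a (Suc k) * ?b (n - k)))"
    by (simp add: Suc derivation_simps(1,4,8)[OF assms] derivation_of_nat_mult[OF assms]
        derivation_simps(2)[OF assms, of "(D ^^ _) _"] Suc_diff_le algebra_simps flip: sum.distrib)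
  \<comment> \<open>The added summand has binomial coefficient 0. After a shift of the index,
    Pascal's rule merges the two sums.\<close>
  also have "(\<Sum>k\<le>n. of_nat (n choose k) * (?a k * ?b (Suc n - k)))
      = (\<Sum>k\<le>Suc n. of_nat (n choose k) * (?a k * ?b (Suc n - k)))"
    by (simp add: binomial_eq_0)
  also have "\<dots> = ?a 0 * ?b (Suc n) + (\<Sum>k\<le>n. of_nat (n choose Suc k) * (?a (Suc k) * ?b (n - k)))"
    by (subst sum.atMost_Suc_shift) simp
  also have "\<dots> + (\<Sum>k\<le>n. of_nat (n choose k) * (?a (Suc k) * ?b (n - k)))
      = ?a 0 * ?b (Suc n) + (\<Sum>k\<le>n. of_nat (Suc n choose Suc k) * (?a (Suc k) * ?b (n - k)))"
    by (simp add: algebra_simps flip: sum.distrib)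
  also have "\<dots> = (\<Sum>k\<le>Suc n. of_nat (Suc n choose k) * (?a k * ?b (Suc n - k)))"
    by (subst sum.atMost_Suc_shift) simp
  finally show ?case .
qed simp

section \<open>Submodules over R\<close>

definition submod :: "'a::comm_ring_1 poly poly set \<Rightarrow> bool" where
  "submod V \<longleftrightarrow> 0 \<in> V \<and> (\<forall>p\<in>V. \<forall>q\<in>V. p + q \<in> V) \<and> (\<forall>a. \<forall>p\<in>V. cnst a * p \<in> V)"

lemma submod_0: "submod V \<Longrightarrow> 0 \<in> V"
  and submod_add: "submod V \<Longrightarrow> p \<in> V \<Longrightarrow> q \<in> V \<Longrightarrow> p + q \<in> V"
  and submod_cnst: "submod V \<Longrightarrow> p \<in> V \<Longrightarrow> cnst a * p \<in> V"
  by (auto simp: submod_def)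

lemma submod_diff: "submod V \<Longrightarrow> p \<in> V \<Longrightarrow> q \<in> V \<Longrightarrow> p - q \<in> V"
  using submod_add[of V p "cnst (- 1) * q"] submod_cnst[of V q "- 1"] by simp

lemma submod_sum: "submod V \<Longrightarrow> (\<And>i. i \<in> S \<Longrightarrow> u i \<in> V) \<Longrightarrow> sum u S \<in> V"
  by (induction S rule: infinite_finite_induct) (simp_all add: submod_0 submod_add)

lemma cnst_mult: "cnst a * p = smult [:a:] p"
  by (simp add: cnst_def)

lemma degree_cnst_mult_le: "degree (cnst a * p) \<le> degree p"
  by (simp add: cnst_mult degree_smult_le)

text \<open>Inverses in a commutative ring are unique, so the description defining
  \<open>unit_inv\<close> denotes.\<close>

lemma unit_inv_right:
  fixes u :: "'a::idom"
  assumes "u dvd 1" shows "u * unit_inv u = 1"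
proof -
  obtain v where v: "u * v = 1" using assms by (metis dvdE)
  then have "w = v" if "u * w = 1" for w
    using that by (metis mult.left_commute mult.right_neutral)
  with v show ?thesis unfolding unit_inv_def by (rule theI[of "\<lambda>v. u * v = 1"])
qed

text \<open>That R contains the rationals is expressed by invertibility of the positive integers;
  \<open>ty\<close> fixes the coefficient type.\<close>

locale Q_domain =
  fixes ty :: "'a::idom itself"
  assumes of_nat_dvd_1: "n > 0 \<Longrightarrow> (of_nat n :: 'a) dvd 1"
begin

abbreviation ifact :: "nat \<Rightarrow> 'a" where "ifact l \<equiv> unit_inv (of_nat (fact l))"

lemma fact_ifact: "of_nat (fact l) * ifact l = 1"
  by (simp add: unit_inv_right of_nat_dvd_1 del: of_nat_fact)

lemma ifact_0_1 [simp]: "unit_inv (1 :: 'a) = 1"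
  using unit_inv_right[of "1::'a"] by simp

lemma ifact_mult:
  assumes "k \<le> n" shows "of_nat (n choose k) * ifact n = ifact k * ifact (n - k)"
proof -
  have *: "x * y * (a * b * c * z) = (a * x) * (b * y) * (c * z)" for a b c x y z :: 'a
    by (simp add: ac_simps)
  have "of_nat (fact k) * of_nat (fact (n - k)) * of_nat (n choose k) = (of_nat (fact n) :: 'a)"
    by (simp only: binomial_fact_lemma[OF assms] flip: of_nat_mult)
  with *[of "ifact k" "ifact (n - k)" "of_nat (fact k)" "of_nat (fact (n - k))"
      "of_nat (n choose k)" "ifact n"]
  show ?thesis by (simp only: fact_ifact mult_1 mult_1_right)
qed

definition dpow :: "('a poly poly \<Rightarrow> 'a poly poly) \<Rightarrow> nat \<Rightarrow> 'a poly poly \<Rightarrow> 'a poly poly" where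
  "dpow D l p = cnst (ifact l) * (D ^^ l) p"

text \<open>Since C(n,k)/n! = 1/(k!(n-k)!), the Leibniz rule divided by n! is a Cauchy
  product.\<close>

lemma dpow_mult:
  assumes "R_derivation D"
  shows "dpow D n (p * q) = (\<Sum>k\<le>n. dpow D k p * dpow D (n - k) q)"
  unfolding dpow_def Leibniz[OF assms] sum_distrib_left
proof (rule sum.cong)
  fix k assume "k \<in> {..n}"
  then have "cnst (of_nat (n choose k) * ifact n) = cnst (ifact k * ifact (n - k))"
    by (simp only: ifact_mult atMost_iff)
  then have "cnst (ifact n) * of_nat (n choose k) = cnst (ifact k) * cnst (ifact (n - k))"
    by (simp add: cnst_of_nat mult.commute)
  then have "cnst (ifact n) * of_nat (n choose k) * ((D ^^ k) p * (D ^^ (n - k)) q)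
      = cnst (ifact k) * cnst (ifact (n - k)) * ((D ^^ k) p * (D ^^ (n - k)) q)"
    by (rule arg_cong)
  then show "cnst (ifact n) * (of_nat (n choose k) * ((D ^^ k) p * (D ^^ (n - k)) q))
      = cnst (ifact k) * (D ^^ k) p * (cnst (ifact (n - k)) * (D ^^ (n - k)) q)"
    by (simp only: ac_simps)
qed simp

text \<open>Terms from the least annihilating index on vanish, so any annihilating index may serve
  as cut-off.\<close>

lemma lnd_exp_eq_sum:
  assumes "R_derivation D" "(D ^^ M) p = 0"
  shows "lnd_exp D p = (\<Sum>l<M. dpow D l p)"
proof -
  let ?m = "LEAST m. (D ^^ m) p = 0"
  have m: "(D ^^ ?m) p = 0" "?m \<le> M" using assms(2) by (auto intro: LeastI Least_le)
  show ?thesis unfolding lnd_exp_def dpow_def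
    by (rule sum.mono_neutral_left) (use m iterate_vanish[OF assms(1) m(1)] in auto)
qed

text \<open>The polynomial is exp(tD) p in a further variable t, evaluated at t = 1. Additivity and
  multiplicativity of \<open>lnd_exp\<close> thus reduce to comparing coefficients.\<close>

lemma lnd_exp_poly:
  assumes "is_LND D"
  shows "\<exists>P. (\<forall>n. coeff P n = dpow D n p) \<and> poly P 1 = lnd_exp D p"
proof -
  have D: "R_derivation D" using assms by (simp add: is_LND_def)
  obtain M where M: "(D ^^ M) p = 0" using assms by (auto simp: is_LND_def)
  let ?P = "\<Sum>l<M. monom (dpow D l p) l"
  have "coeff ?P n = dpow D n p" for n
    using iterate_vanish[OF D M, of n] by (auto simp: coeff_sum dpow_def not_less)
  moreover have "poly ?P 1 = lnd_exp D p"
    by (simp add: lnd_exp_eq_sum[OF D M] poly_sum poly_monom)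
  ultimately show ?thesis by blast
qed

lemma R_hom_lnd_exp:
  fixes D :: "'a poly poly \<Rightarrow> 'a poly poly"
  assumes "is_LND D" shows "R_hom (lnd_exp D)"
  unfolding R_hom_def
proof (intro conjI allI)
  have D: "R_derivation D" using assms by (simp add: is_LND_def)
  fix p q
  obtain P where P: "\<And>n. coeff P n = dpow D n p" "poly P 1 = lnd_exp D p"
    using lnd_exp_poly[OF assms] by blast
  obtain Q where Q: "\<And>n. coeff Q n = dpow D n q" "poly Q 1 = lnd_exp D q"
    using lnd_exp_poly[OF assms] by blast
  obtain S where S: "\<And>n. coeff S n = dpow D n (p + q)" "poly S 1 = lnd_exp D (p + q)"
    using lnd_exp_poly[OF assms] by blast
  obtain T where T: "\<And>n. coeff T n = dpow D n (p * q)" "poly T 1 = lnd_exp D (p * q)"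
    using lnd_exp_poly[OF assms] by blast
  have "S = P + Q"
    by (rule poly_eqI) (simp add: S P Q dpow_def derivation_iterate_simps[OF D] algebra_simps)
  then show "lnd_exp D (p + q) = lnd_exp D p + lnd_exp D q" using S P Q by auto
  have "T = P * Q"
    by (rule poly_eqI) (simp add: T P Q coeff_mult dpow_mult[OF D])
  then show "lnd_exp D (p * q) = lnd_exp D p * lnd_exp D q" using T P Q by auto
  show "lnd_exp D (cnst a) = cnst a" for a
    using lnd_exp_eq_sum[OF D, of 1 "cnst a"] by (simp add: derivation_simps[OF D] dpow_def)
qed

lemma lnd_exp_split:
  assumes "R_derivation D" "(D ^^ Suc m) p = 0"
  shows "lnd_exp D p = p + (\<Sum>l<m. cnst (ifact (Suc l)) * (D ^^ Suc l) p)"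
  unfolding lnd_exp_eq_sum[OF assms] sum.lessThan_Suc_shift by (simp add: dpow_def)

text \<open>exp D is unipotent: \<open>lnd_exp D p - p\<close> is annihilated by one iterate fewer
  than \<open>p\<close>. Injectivity and surjectivity follow by induction on the annihilating
  index.\<close>

lemma R_aut_lnd_exp:
  fixes D :: "'a poly poly \<Rightarrow> 'a poly poly"
  assumes "is_LND D" shows "R_aut (lnd_exp D)"
proof -
  have D: "R_derivation D" using assms by (simp add: is_LND_def)
  note h = R_hom_simps[OF R_hom_lnd_exp[OF assms]]
  have comp: "(D ^^ m) ((D ^^ n) p) = (D ^^ (m + n)) p" for m n p
    by (simp add: funpow_add)
  have 0: "p = 0" if "lnd_exp D p = 0" "(D ^^ m) p = 0" for p m
    using that(2)
  proof (induction m)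
    case (Suc m)
    \<comment> \<open>Applying \<open>D ^^ m\<close> kills all summands but the first, so
      \<open>m\<close> already annihilates \<open>p\<close>.\<close>
    have "0 = (D ^^ m) (lnd_exp D p)" by (simp add: that derivation_iterate_simps[OF D])
    also have "\<dots> = (D ^^ m) p + (\<Sum>l<m. cnst (ifact (Suc l)) * (D ^^ (m + Suc l)) p)"
      by (simp add: lnd_exp_split[OF D Suc.prems] derivation_iterate_simps[OF D] comp
          del: funpow.simps fact_Suc)
    also have "\<dots> = (D ^^ m) p"
      by (simp add: iterate_vanish[OF D Suc.prems] del: funpow.simps fact_Suc)
    finally show ?case using Suc.IH by simp
  qed simp
  have "inj (lnd_exp D)"
  proof (rule injI)
    fix p q assume "lnd_exp D p = lnd_exp D q"
    then have "lnd_exp D (p - q) = 0" by (simp add: h)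
    moreover obtain m where "(D ^^ m) (p - q) = 0" using assms by (auto simp: is_LND_def)
    ultimately show "p = q" using 0[of "p - q"] by simp
  qed
  moreover have r: "p \<in> range (lnd_exp D)" if "(D ^^ m) p = 0" for p m
    using that
  proof (induction m arbitrary: p)
    case 0
    then show ?case using h(4) by (metis funpow_0 rangeI)
  next
    case (Suc m)
    \<comment> \<open>The difference is annihilated by \<open>m\<close>, hence lies in the range by
      induction; then so does \<open>p\<close>.\<close>
    have "(D ^^ m) (p - lnd_exp D p) = - (\<Sum>l<m. cnst (ifact (Suc l)) * (D ^^ (m + Suc l)) p)"
      by (simp add: lnd_exp_split[OF D Suc.prems] derivation_iterate_simps[OF D] comp
          del: funpow.simps fact_Suc)
    also have "\<dots> = 0"
      by (simp add: iterate_vanish[OF D Suc.prems] del: funpow.simps fact_Suc)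
    finally obtain q where "p - lnd_exp D p = lnd_exp D q" using Suc.IH by blast
    then have "p = lnd_exp D (q + p)" by (simp add: h algebra_simps)
    then show ?case by blast
  qed
  then have "surj (lnd_exp D)"
    using assms unfolding is_LND_def by blast
  ultimately show ?thesis using R_hom_lnd_exp[OF assms] by (simp add: R_aut_iff bij_def)
qed

lemma lnd_exp_closed:
  fixes D :: "'a poly poly \<Rightarrow> 'a poly poly"
  assumes "is_LND D" "submod V" "\<And>p. p \<in> V \<Longrightarrow> D p \<in> V" "p \<in> V"
  shows "lnd_exp D p \<in> V"
proof -
  have "(D ^^ l) p \<in> V" for l using assms(3,4) by (induction l) auto
  then show ?thesis unfolding lnd_exp_def by (intro submod_sum submod_cnst assms(2))
qed

text \<open>The logarithm of an exponential, without the logarithm series: the induction is on the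
  nilpotency index of \<open>p\<close>, and \<open>w = lnd_exp D p - p\<close> has a smaller one.\<close>

lemma iterate_closed_if_lnd_exp_closed:
  fixes D :: "'a poly poly \<Rightarrow> 'a poly poly"
  assumes "is_LND D" "submod V" and F: "\<And>p. p \<in> V \<Longrightarrow> lnd_exp D p \<in> V" and "p \<in> V"
  shows "(D ^^ j) p \<in> V"
proof -
  have D: "R_derivation D" using assms by (simp add: is_LND_def)
  have comp: "(D ^^ m) ((D ^^ n) p) = (D ^^ (m + n)) p" for m n p
    by (simp add: funpow_add)
  have "(D ^^ j) p \<in> V" if "(D ^^ m) p = 0" "p \<in> V" for m j
    using that
  proof (induction m arbitrary: p j)
    case 0
    then show ?case by (simp add: derivation_iterate_simps[OF D] submod_0[OF assms(2)])
  next
    case (Suc m)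
    define w where "w = lnd_exp D p - p"
    have Dw: "(D ^^ j) w = (\<Sum>l<m. cnst (ifact (Suc l)) * (D ^^ (j + Suc l)) p)" for j
      by (simp add: w_def lnd_exp_split[OF D Suc.prems(1)] derivation_iterate_simps[OF D] comp
          del: funpow.simps fact_Suc)
    have "(D ^^ m) w = 0"
      unfolding Dw by (simp add: iterate_vanish[OF D Suc.prems(1)] del: funpow.simps fact_Suc)
    moreover have "w \<in> V" unfolding w_def by (intro submod_diff assms(2) F Suc.prems)
    ultimately have w: "(D ^^ j) w \<in> V" for j by (rule Suc.IH)
    \<comment> \<open>Downward induction on \<open>j\<close>: since 1/1! = 1,
      \<open>(D ^^ j) w\<close> is \<open>(D ^^ Suc j) p\<close> plus scalar multiples of higher
      iterates of \<open>p\<close>, which lie in \<open>V\<close> already.\<close>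
    have "(D ^^ Suc j) p \<in> V" for j
    proof (induction "m - j" arbitrary: j rule: less_induct)
      case less
      show ?case
      proof (cases "j < m")
        case False
        then show ?thesis
          using iterate_vanish[OF D Suc.prems(1), of "Suc j"] submod_0[OF assms(2)] by simp
      next
        case True
        then obtain n where n: "m = Suc n" by (cases m) auto
        have "(D ^^ j) w = (D ^^ Suc j) p
            + (\<Sum>l<n. cnst (ifact (Suc (Suc l))) * (D ^^ Suc (j + Suc l)) p)"
          unfolding Dw n sum.lessThan_Suc_shift by simp
        then have "(D ^^ Suc j) p = (D ^^ j) w
            - (\<Sum>l<n. cnst (ifact (Suc (Suc l))) * (D ^^ Suc (j + Suc l)) p)"
          by (simp only: add_diff_cancel_right')
        moreover have "(D ^^ Suc (j + Suc l)) p \<in> V" for l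
          using True by (intro less) simp
        ultimately show ?thesis
          by (auto intro!: submod_diff submod_sum submod_cnst assms(2) w simp del: funpow.simps fact_Suc)
      qed
    qed
    then show ?case using Suc.prems(2) by (cases j) (auto simp del: funpow.simps(2))
  qed
  moreover obtain m where "(D ^^ m) p = 0" using assms(1) by (auto simp: is_LND_def)
  ultimately show ?thesis using assms(4) by blast
qed

text \<open>Only finitely many iterates of \<open>D\<close> on \<open>p\<close> are nonzero, so
  their degrees in x2 have a common bound \<open>d\<close>. The polynomials all of whose iterates
  obey this bound form a \<open>D\<close>-stable submodule, which exp D therefore preserves.\<close>

lemma degree_lnd_exp_iterates_bounded:
  fixes D :: "'a poly poly \<Rightarrow> 'a poly poly"
  assumes "is_LND D"
  shows "\<exists>d. \<forall>k. degree ((lnd_exp D ^^ k) p) \<le> d"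
proof -
  have D: "R_derivation D" using assms by (simp add: is_LND_def)
  obtain m where m: "(D ^^ m) p = 0" using assms by (auto simp: is_LND_def)
  define d where "d = Max ((\<lambda>l. degree ((D ^^ l) p)) ` {..m})"
  define U where "U = {q. \<forall>l. degree ((D ^^ l) q) \<le> d}"
  have U: "submod U"
    unfolding submod_def U_def
    by (auto simp: derivation_iterate_simps[OF D] intro: degree_add_le
        order_trans[OF degree_cnst_mult_le])
  have "degree ((D ^^ l) p) \<le> d" for l
  proof (cases "l \<le> m")
    case True
    then show ?thesis unfolding d_def by (intro Max_ge) auto
  next
    case False
    then show ?thesis using iterate_vanish[OF D m, of l] by simp
  qed
  then have "p \<in> U" by (simp add: U_def)
  have "D q \<in> U" if "q \<in> U" for q
    unfolding U_def
  proof (intro CollectI allI)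
    show "degree ((D ^^ l) (D q)) \<le> d" for l
      using that unfolding U_def mem_Collect_eq by (metis funpow_swap1 funpow.simps(2) comp_apply)
  qed
  then have "lnd_exp D q \<in> U" if "q \<in> U" for q
    using lnd_exp_closed[OF assms U] that by blast
  then have "(lnd_exp D ^^ k) p \<in> U" for k
    using \<open>p \<in> U\<close> by (induction k) auto
  then have "degree ((D ^^ 0) ((lnd_exp D ^^ k) p)) \<le> d" for k
    unfolding U_def by blast
  then show ?thesis by auto
qed

end

section \<open>Rescaling and conjugating locally nilpotent derivations\<close>

lemma is_LND_mult:
  assumes "is_LND D" "D f = 0" shows "is_LND (\<lambda>p. f * D p)"
proof -
  have D: "R_derivation D" using assms by (simp add: is_LND_def)
  \<comment> \<open>Powers of \<open>f\<close> behave as constants for \<open>D\<close>, whence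
    (fD)^n = f^n D^n.\<close>
  have 1: "D (f ^ n * p) = f ^ n * D p" for n p
    by (induction n arbitrary: p)
      (simp_all add: derivation_simps(2)[OF D, of f] assms(2) mult.assoc)
  have "((\<lambda>p. f * D p) ^^ n) p = f ^ n * (D ^^ n) p" for n p
    by (induction n) (simp_all add: 1 mult.assoc)
  moreover have "R_derivation (\<lambda>p. f * D p)"
    using D by (auto simp: R_derivation_def algebra_simps)
  moreover have "\<exists>m. f ^ m * (D ^^ m) p = 0" for p
    using assms(1) unfolding is_LND_def by (metis mult_zero_right)
  ultimately show ?thesis by (simp add: is_LND_def)
qed

lemma conj_iterate:
  assumes "R_aut g" shows "((g \<circ> D \<circ> inv g) ^^ n) p = g ((D ^^ n) (inv g p))"
  by (induction n) (simp_all add: R_aut_inv_cancel[OF assms])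

lemma is_LND_conj:
  assumes "R_aut g" "is_LND D" shows "is_LND (g \<circ> D \<circ> inv g)"
proof -
  have D: "R_derivation D" using assms by (simp add: is_LND_def)
  note h = R_hom_simps[OF R_aut_hom[OF assms(1)]] R_hom_simps[OF R_aut_hom[OF R_aut_inv[OF assms(1)]]]
  have "R_derivation (g \<circ> D \<circ> inv g)"
    by (simp add: R_derivation_def h derivation_simps[OF D] R_aut_inv_cancel[OF assms(1)])
  moreover have "\<exists>m. ((g \<circ> D \<circ> inv g) ^^ m) p = 0" for p
    unfolding conj_iterate[OF assms(1)] using assms(2) unfolding is_LND_def by (metis h(4))
  ultimately show ?thesis by (simp add: is_LND_def)
qed

text \<open>As \<open>g\<close> is injective, the cut-offs chosen by \<open>LEAST\<close> agree on
  both sides.\<close>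

lemma lnd_exp_conj:
  assumes "R_aut g" shows "lnd_exp (g \<circ> D \<circ> inv g) = g \<circ> lnd_exp D \<circ> inv g"
proof
  note h = R_hom_simps[OF R_aut_hom[OF assms]]
  have sum: "g (sum u S) = (\<Sum>i\<in>S. g (u i))" for u :: "nat \<Rightarrow> _" and S
    by (induction S rule: infinite_finite_induct) (simp_all add: h)
  show "lnd_exp (g \<circ> D \<circ> inv g) p = (g \<circ> lnd_exp D \<circ> inv g) p" for p
    unfolding lnd_exp_def conj_iterate[OF assms] R_aut_eq_0_iff[OF assms]
    by (simp add: sum h)
qed

section \<open>Affine and triangular automorphisms\<close>

definition lin :: "'a::comm_ring_1 poly poly set" where
  "lin = {q. \<exists>a b c. q = [:[:a, b:], [:c:]:]}"

definition lin1 :: "'a::comm_ring_1 poly poly set" where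
  "lin1 = {q. \<exists>a b. q = [:[:a, b:]:]}"

text \<open>The automorphisms of \<open>affine_aut\<close>, with total degree one replaced by
  membership in a module, a condition that passes to logarithms and back.\<close>

definition Aff :: "('a::comm_ring_1 poly poly \<Rightarrow> 'a poly poly) set" where
  "Aff = {\<phi>. R_aut \<phi> \<and> \<phi> X1 \<in> lin \<and> \<phi> X2 \<in> lin}"

text \<open>Stability of the span of 1 and x1 is what passes to the logarithm. The shape of the
  image of x2 is then forced by invertibility, see \<open>Tri_X2\<close>.\<close>

definition Tri :: "('a::comm_ring_1 poly poly \<Rightarrow> 'a poly poly) set" where
  "Tri = {\<phi>. R_aut \<phi> \<and> \<phi> X1 \<in> lin1}"

lemma lin_expand: "[:[:a, b:], [:c:]:] = cnst a + cnst b * X1 + cnst c * X2"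
  by (simp add: cnst_def X1_def X2_def)

lemma lin1_expand: "[:[:a, b:]:] = cnst a + cnst b * X1"
  by (simp add: cnst_def X1_def)

lemma linI: "cnst a + cnst b * X1 + cnst c * X2 \<in> lin"
  unfolding lin_def lin_expand by blast

lemma lin1I: "cnst a + cnst b * X1 \<in> lin1"
  unfolding lin1_def lin1_expand by blast

lemma linE:
  assumes "q \<in> lin" obtains a b c where "q = cnst a + cnst b * X1 + cnst c * X2"
  using assms unfolding lin_def lin_expand by blast

lemma lin1E:
  assumes "q \<in> lin1" obtains a b where "q = cnst a + cnst b * X1"
  using assms unfolding lin1_def lin1_expand by blast

lemma lin_mem: "cnst a \<in> lin" "X1 \<in> lin" "X2 \<in> lin"
  using linI[of a 0 0] linI[of 0 1 0] linI[of 0 0 1] by simp_all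

lemma lin1_mem: "cnst a \<in> lin1" "X1 \<in> lin1"
  using lin1I[of a 0] lin1I[of 0 1] by simp_all

lemma submod_lin: "submod lin"
proof -
  have "0 \<in> lin" using linI[of 0 0 0] by simp
  moreover have "p + q \<in> lin" if "p \<in> lin" "q \<in> lin" for p q :: "'a poly poly"
    using that unfolding lin_def by force
  moreover have "cnst a * p \<in> lin" if "p \<in> lin" for p and a :: 'a
    using that unfolding lin_def cnst_mult by force
  ultimately show ?thesis by (auto simp: submod_def)
qed

lemma submod_lin1: "submod lin1"
proof -
  have "0 \<in> lin1" using lin1I[of 0 0] by simp
  moreover have "p + q \<in> lin1" if "p \<in> lin1" "q \<in> lin1" for p q :: "'a poly poly"
    using that unfolding lin1_def by force
  moreover have "cnst a * p \<in> lin1" if "p \<in> lin1" for p and a :: 'a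
    using that unfolding lin1_def cnst_mult by force
  ultimately show ?thesis by (auto simp: submod_def)
qed

lemma hom_lin:
  assumes "R_hom \<phi>" "\<phi> X1 \<in> lin" "\<phi> X2 \<in> lin" "q \<in> lin" shows "\<phi> q \<in> lin"
proof -
  note h = R_hom_simps[OF assms(1)]
  obtain a b c where "q = cnst a + cnst b * X1 + cnst c * X2" using assms(4) by (rule linE)
  then show ?thesis
    by (simp add: h) (intro submod_add submod_cnst submod_lin assms lin_mem)
qed

lemma hom_lin1:
  assumes "R_hom \<phi>" "\<phi> X1 \<in> lin1" "q \<in> lin1" shows "\<phi> q \<in> lin1"
proof -
  note h = R_hom_simps[OF assms(1)]
  obtain a b where "q = cnst a + cnst b * X1" using assms(3) by (rule lin1E)
  then show ?thesis
    by (simp add: h) (intro submod_add submod_cnst submod_lin1 assms lin1_mem)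
qed

lemma degree_le_1_iff: "degree p \<le> 1 \<longleftrightarrow> (\<exists>a b. p = [:a, b:])"
proof
  assume p: "degree p \<le> 1"
  obtain a q where q: "p = pCons a q" by (cases p)
  with p have "degree q = 0" by (auto split: if_splits)
  then show "\<exists>a b. p = [:a, b:]" using q by (metis degree_eq_zeroE)
qed auto

lemma lin_iff_degree:
  "q \<in> lin \<longleftrightarrow> degree q \<le> 1 \<and> degree (coeff q 0) \<le> 1 \<and> degree (coeff q 1) = 0"
proof
  assume q: "degree q \<le> 1 \<and> degree (coeff q 0) \<le> 1 \<and> degree (coeff q 1) = 0"
  then obtain a b where ab: "q = [:a, b:]" by (auto simp only: degree_le_1_iff)
  with q have "degree a \<le> 1" "degree b = 0" by simp_all
  then show "q \<in> lin" unfolding lin_def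
    by (auto simp: ab degree_le_1_iff simp del: One_nat_def elim!: degree_eq_zeroE)
qed (auto simp: lin_def)

lemma lin1_iff_degree: "q \<in> lin1 \<longleftrightarrow> degree q = 0 \<and> degree (coeff q 0) \<le> 1"
proof
  assume "degree q = 0 \<and> degree (coeff q 0) \<le> 1"
  then show "q \<in> lin1" unfolding lin1_def
    by (auto simp: degree_le_1_iff simp del: One_nat_def elim!: degree_eq_zeroE)
qed (auto simp: lin1_def)

lemma lin1_factor:
  fixes f q :: "'a::idom poly poly"
  assumes "f * q \<in> lin1" "f \<noteq> 0" shows "q \<in> lin1"
proof (cases "q = 0")
  case False
  with assms have "degree f = 0" "degree q = 0"
    by (auto simp: lin1_iff_degree degree_mult_eq)
  then obtain f0 q0 where "f = [:f0:]" "q = [:q0:]" by (metis degree_eq_zeroE)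
  with assms False show ?thesis by (auto simp: lin1_iff_degree degree_mult_eq)
qed (simp add: submod_0[OF submod_lin1])

text \<open>Degrees in x2 add up to at most 1, so one factor is free of x2. Its products with the
  coefficients of the other are then compared by degree in x1. This is what allows division by
  \<open>f\<close> after taking logarithms.\<close>

lemma lin_factor:
  fixes f q :: "'a::idom poly poly"
  assumes "f * q \<in> lin" "f \<noteq> 0" shows "q \<in> lin"
proof (cases "q = 0")
  case False
  have d: "degree (coeff (f * q) 0) \<le> 1" "degree (coeff (f * q) 1) = 0"
    and "degree f + degree q \<le> 1"
    using assms False by (auto simp: lin_iff_degree degree_mult_eq)
  from \<open>degree f + degree q \<le> 1\<close>
  consider f0 q0 q1 where "f = [:f0:]" "q = [:q0, q1:]" | f0 f1 q0 where "f = [:f0, f1:]" "q = [:q0:]"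
  proof (cases "degree f = 0")
    case True
    moreover from this have "degree q \<le> 1" using \<open>degree f + degree q \<le> 1\<close> by simp
    ultimately show ?thesis using that(1) by (metis degree_eq_zeroE degree_le_1_iff)
  next
    case False
    then have "degree f \<le> 1" "degree q = 0" using \<open>degree f + degree q \<le> 1\<close> by simp_all
    then show ?thesis using that(2) by (metis degree_eq_zeroE degree_le_1_iff)
  qed
  then show ?thesis
  proof cases
    case 1
    then have "f0 \<noteq> 0" using assms by auto
    with d 1 show ?thesis
      by (cases "q0 = 0"; cases "q1 = 0") (auto simp: lin_iff_degree degree_mult_eq)
  next
    case 2
    then have "q0 \<noteq> 0" "f0 \<noteq> 0 \<or> f1 \<noteq> 0" using assms False by auto
    with d 2 show ?thesis
      by (cases "f0 = 0"; cases "f1 = 0") (auto simp: lin_iff_degree degree_mult_eq)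
  qed
qed (simp add: submod_0[OF submod_lin])

lemma X1_neq_cnst: "X1 \<noteq> (cnst a :: 'a::comm_ring_1 poly poly)"
  by (simp add: X1_def cnst_def)

lemma aut_eq_cnst_iff: "R_aut \<phi> \<Longrightarrow> \<phi> p = cnst a \<longleftrightarrow> p = cnst a"
  by (metis R_aut_inv_cancel(2) R_aut_hom R_hom_simps(3))

lemma Aff_comp: "\<phi> \<in> Aff \<Longrightarrow> \<psi> \<in> Aff \<Longrightarrow> \<phi> \<circ> \<psi> \<in> Aff"
  by (auto simp: Aff_def R_aut_comp R_aut_hom intro: hom_lin)

lemma Tri_comp: "\<phi> \<in> Tri \<Longrightarrow> \<psi> \<in> Tri \<Longrightarrow> \<phi> \<circ> \<psi> \<in> Tri"
  by (auto simp: Tri_def R_aut_comp R_aut_hom intro: hom_lin1)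

lemma Tri_X1:
  fixes \<phi> :: "'a::idom poly poly \<Rightarrow> 'a poly poly"
  assumes "\<phi> \<in> Tri" obtains a b where "\<phi> X1 = cnst a + cnst b * X1" "b \<noteq> 0"
proof -
  have aut: "R_aut \<phi>" and "\<phi> X1 \<in> lin1" using assms by (auto simp: Tri_def)
  then obtain a b where ab: "\<phi> X1 = cnst a + cnst b * X1" by (auto elim: lin1E)
  moreover have "b \<noteq> 0" using ab aut_eq_cnst_iff[OF aut, of X1 a] X1_neq_cnst[of a] by auto
  ultimately show ?thesis by (rule that)
qed

text \<open>Applying the inverse to \<open>\<phi> X1\<close> shows that
  \<open>cnst b * inv \<phi> X1\<close> lies in \<open>lin1\<close>; the factor \<open>b\<close> is
  removed by \<open>lin1_factor\<close>.\<close>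

lemma Tri_inv:
  fixes \<phi> :: "'a::idom poly poly \<Rightarrow> 'a poly poly"
  assumes "\<phi> \<in> Tri" shows "inv \<phi> \<in> Tri"
proof -
  have aut: "R_aut \<phi>" using assms by (auto simp: Tri_def)
  obtain a b where ab: "\<phi> X1 = cnst a + cnst b * X1" "b \<noteq> 0" using assms by (rule Tri_X1)
  note h = R_hom_simps[OF R_aut_hom[OF R_aut_inv[OF aut]]]
  have "inv \<phi> (\<phi> X1) = X1" by (simp add: R_aut_inv_cancel[OF aut])
  then have "cnst b * inv \<phi> X1 = X1 - cnst a" by (simp add: ab h algebra_simps)
  also have "\<dots> \<in> lin1" by (intro submod_diff submod_lin1 lin1_mem)
  finally have "inv \<phi> X1 \<in> lin1" by (rule lin1_factor) (simp add: ab)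
  then show ?thesis using R_aut_inv[OF aut] by (simp add: Tri_def)
qed

text \<open>Cramer's rule puts the determinant times the images under the inverse into
  \<open>lin\<close>; a nonzero determinant is then removed by \<open>lin_factor\<close>.\<close>

lemma Aff_inv:
  fixes \<phi> :: "'a::idom poly poly \<Rightarrow> 'a poly poly"
  assumes "\<phi> \<in> Aff" shows "inv \<phi> \<in> Aff"
proof -
  have aut: "R_aut \<phi>" and l: "\<phi> X1 \<in> lin" "\<phi> X2 \<in> lin" using assms by (auto simp: Aff_def)
  obtain a b c where 1: "\<phi> X1 = cnst a + cnst b * X1 + cnst c * X2" using l(1) by (rule linE)
  obtain a' b' c' where 2: "\<phi> X2 = cnst a' + cnst b' * X1 + cnst c' * X2" using l(2) by (rule linE)
  note h = R_hom_simps[OF R_aut_hom[OF R_aut_inv[OF aut]]]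
  define d where "d = b * c' - b' * c"
  have "inv \<phi> (\<phi> X1) = X1" "inv \<phi> (\<phi> X2) = X2" by (simp_all add: R_aut_inv_cancel[OF aut])
  then have e: "X1 = cnst a + cnst b * inv \<phi> X1 + cnst c * inv \<phi> X2"
      "X2 = cnst a' + cnst b' * inv \<phi> X1 + cnst c' * inv \<phi> X2"
    by (simp_all add: 1 2 h)
  have e1: "cnst d * inv \<phi> X1 = cnst (c * a' - c' * a) + cnst c' * X1 + cnst (- c) * X2"
    unfolding d_def by (subst e(1), subst e(2)) (simp add: algebra_simps)
  have e2: "cnst d * inv \<phi> X2 = cnst (b' * a - b * a') + cnst (- b') * X1 + cnst b * X2"
    unfolding d_def by (subst e(1), subst e(2)) (simp add: algebra_simps)
  \<comment> \<open>With determinant 0 the two Cramer identities force \<open>b = c = 0\<close>, so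
    \<open>\<phi>\<close> would send \<open>X1\<close> to a constant.\<close>
  have "d \<noteq> 0"
  proof
    assume "d = 0"
    then have "b = 0" "c = 0"
      using e1 e2 by (simp_all add: lin_expand[symmetric] del: cnst_simps(3-6))
    then have "\<phi> X1 = cnst a" using 1 by simp
    then show False using aut_eq_cnst_iff[OF aut] X1_neq_cnst by blast
  qed
  moreover have "cnst d * inv \<phi> X1 \<in> lin" "cnst d * inv \<phi> X2 \<in> lin"
    unfolding e1 e2 by (rule linI)+
  ultimately have "inv \<phi> X1 \<in> lin" "inv \<phi> X2 \<in> lin" by (auto intro: lin_factor)
  then show ?thesis using R_aut_inv[OF aut] by (simp add: Aff_def)
qed

text \<open>On polynomials in x1 alone a homomorphism is composition with the image of
  \<open>X1\<close>. Lifting the coefficients makes \<open>degree_pcompose\<close> count degrees in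
  x2.\<close>

lemma pcompose_map_hom:
  assumes "R_hom \<phi>"
  shows "\<phi> [:p:] = pcompose (map_poly (\<lambda>c. [:c:]) p) (\<phi> X1)"
proof (induction p)
  case (pCons a p)
  then show ?case
    by (simp only: pCons_pCons_eq R_hom_simps[OF assms])
      (simp add: map_poly_pCons pcompose_pCons cnst_def)
qed (simp add: R_hom_simps[OF assms])

lemma degree_hom_inner:
  fixes \<phi> :: "'a::idom poly poly \<Rightarrow> 'a poly poly"
  assumes "R_hom \<phi>"
  shows "degree (\<phi> [:p:]) = degree p * degree (\<phi> X1)"
  unfolding pcompose_map_hom[OF assms] by (simp add: degree_pcompose degree_map_poly)

text \<open>\<open>\<phi>\<close> acts on the coefficients in R[x1] by the substitution
  \<open>u\<close> and then composes in x2 with \<open>\<phi> X2\<close>. Degrees in x2 multiply, so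
  a preimage of \<open>X2\<close> forces \<open>\<phi> X2\<close> to be of degree 1.\<close>

lemma Tri_X2:
  fixes \<phi> :: "'a::idom poly poly \<Rightarrow> 'a poly poly"
  assumes "\<phi> \<in> Tri" obtains p b where "\<phi> X2 = [:p:] + cnst b * X2"
proof -
  have aut: "R_aut \<phi>" using assms by (auto simp: Tri_def)
  note h = R_hom_simps[OF R_aut_hom[OF aut]]
  obtain a b where ab: "\<phi> X1 = cnst a + cnst b * X1" "b \<noteq> 0" using assms by (rule Tri_X1)
  define u where "u = [:a, b:]"
  have u: "\<phi> X1 = [:u:]" "degree u = 1" using ab by (simp_all add: u_def lin1_expand)
  have inner: "\<phi> [:p:] = [:pcompose p u:]" for p
  proof (induction p)
    case (pCons c p)
    then show ?case
      by (simp only: pCons_pCons_eq h) (simp add: u pcompose_pCons cnst_def)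
  qed (simp add: h)
  have pc: "\<phi> q = pcompose (map_poly (\<lambda>c. pcompose c u) q) (\<phi> X2)" for q
  proof (induction q)
    case (pCons c q)
    then show ?case
      by (simp only: pCons_eq_X2[of c q] h inner)
        (simp add: map_poly_pCons pcompose_pCons flip: pCons_eq_X2)
  qed (simp add: h)
  define q where "q = inv \<phi> X2"
  \<comment> \<open>No leading coefficient is lost, because \<open>u\<close> is not
    constant.\<close>
  have "pcompose c u = 0 \<longleftrightarrow> c = 0" for c using u(2) by (simp add: pcompose_eq_0_iff)
  then have "degree (\<phi> q) = degree q * degree (\<phi> X2)"
    unfolding pc[of q] by (simp add: degree_pcompose degree_map_poly)
  moreover have q: "\<phi> q = X2" by (simp add: q_def R_aut_inv_cancel[OF aut])
  ultimately have "degree q * degree (\<phi> X2) = 1" by (simp add: X2_def)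
  then have "degree q = 1" "degree (\<phi> X2) = 1" by auto
  then obtain q0 q1 v0 v1 where qv: "q = [:q0, q1:]" "\<phi> X2 = [:v0, v1:]"
    by (metis degree_le_1_iff order_refl)
  have "X2 = [:pcompose q0 u:] + [:v0, v1:] * [:pcompose q1 u:]"
    using q unfolding qv pc[of "[:q0, q1:]"] by (simp add: map_poly_pCons pcompose_pCons)
  \<comment> \<open>Comparing coefficients of x2 shows that \<open>v1\<close> is a unit of R[x1],
    hence of degree 0.\<close>
  then have "coeff X2 1 = coeff ([:pcompose q0 u:] + [:v0, v1:] * [:pcompose q1 u:]) 1"
    by (rule arg_cong)
  then have "v1 * pcompose q1 u = 1" by (simp add: X2_def mult.commute)
  then have "degree v1 = 0"
    by (metis add_is_0 degree_1 degree_mult_eq mult_zero_left mult_zero_right one_neq_zero)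
  then obtain c where "v1 = [:c:]" by (rule degree_eq_zeroE)
  then have "\<phi> X2 = [:v0:] + cnst c * X2" by (simp add: qv cnst_def) (simp add: X2_def)
  then show ?thesis by (rule that)
qed

section \<open>Tame automorphisms as words\<close>

lemma coeff_nonzero_le_totdeg:
  assumes "coeff (coeff p j) i \<noteq> 0" shows "i + j \<le> totdeg p"
    and finite_exponents: "finite {i + j | i j. coeff (coeff p j) i \<noteq> 0}"
proof -
  have "{i + j | i j. coeff (coeff p j) i \<noteq> 0} \<subseteq> (\<Union>j\<le>degree p. (\<lambda>i. i + j) ` {..degree (coeff p j)})"
    by (auto intro!: bexI imageI le_degree)
  then show f: "finite {i + j | i j. coeff (coeff p j) i \<noteq> 0}" by (rule finite_subset) auto
  show "i + j \<le> totdeg p" unfolding totdeg_def using assms by (intro Max_ge f) auto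
qed

lemma totdeg_le_1_imp_lin:
  assumes "totdeg p \<le> 1" shows "p \<in> lin"
proof -
  have 0: "coeff (coeff p j) i = 0" if "i + j > 1" for i j
    using coeff_nonzero_le_totdeg(1)[of p j i] assms that by force
  have "p = [:[:coeff (coeff p 0) 0, coeff (coeff p 0) 1:], [:coeff (coeff p 1) 0:]:]"
  proof (intro poly_eqI)
    show "coeff (coeff p j) i
        = coeff (coeff [:[:coeff (coeff p 0) 0, coeff (coeff p 0) 1:], [:coeff (coeff p 1) 0:]:] j) i"
      for i j by (auto simp: coeff_pCons split: nat.split intro: 0)
  qed
  then show ?thesis unfolding lin_def by blast
qed

text \<open>Constants are excluded: nonzero ones have total degree 0, and for 0 the maximum runs
  over the empty set.\<close>

lemma lin_imp_totdeg_1: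
  assumes "p \<in> lin" "\<And>a. p \<noteq> cnst a" shows "totdeg p = 1"
proof -
  obtain a b c where p: "p = [:[:a, b:], [:c:]:]" using assms(1) by (auto simp: lin_def)
  then have bc: "b \<noteq> 0 \<or> c \<noteq> 0" using assms(2)[of a] by (auto simp: cnst_def)
  have le: "i + j \<le> 1" if "coeff (coeff p j) i \<noteq> 0" for i j
    using that by (auto simp: p coeff_pCons split: nat.splits)
  have "1 \<le> totdeg p"
    using bc coeff_nonzero_le_totdeg(1)[of p 0 1] coeff_nonzero_le_totdeg(1)[of p 1 0]
    by (auto simp: p)
  moreover have "totdeg p \<le> 1"
    unfolding totdeg_def
  proof (rule Max.boundedI)
    show "finite {i + j | i j. coeff (coeff p j) i \<noteq> 0}"
      using bc finite_exponents[of p 0 1] finite_exponents[of p 1 0] by (auto simp: p)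
    show "{i + j | i j. coeff (coeff p j) i \<noteq> 0} \<noteq> {}"
    proof -
      have "coeff (coeff p 0) 1 \<noteq> 0 \<or> coeff (coeff p 1) 0 \<noteq> 0" using bc by (simp add: p)
      then show ?thesis by blast
    qed
  qed (use le in auto)
  ultimately show ?thesis by simp
qed

lemma X2_neq_cnst: "X2 \<noteq> (cnst a :: 'a::comm_ring_1 poly poly)"
  by (simp add: X2_def cnst_def)

lemma Aff_tame: "\<phi> \<in> Aff \<Longrightarrow> \<phi> \<in> tame"
proof (rule tame.gen, rule disjI1)
  assume "\<phi> \<in> Aff"
  then have aut: "R_aut \<phi>" and l: "\<phi> X1 \<in> lin" "\<phi> X2 \<in> lin" by (auto simp: Aff_def)
  have "\<phi> X1 \<noteq> cnst a" "\<phi> X2 \<noteq> cnst a" for a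
    using aut_eq_cnst_iff[OF aut] X1_neq_cnst X2_neq_cnst by blast+
  then show "affine_aut \<phi>"
    using aut l lin_imp_totdeg_1 cnst_simps(1) unfolding affine_aut_def by metis
qed

text \<open>Splitting off the affine map \<open>g\<close> that agrees with \<open>\<phi>\<close> on
  \<open>X1\<close> and fixes \<open>X2\<close> leaves an elementary automorphism fixing
  \<open>X1\<close>.\<close>

lemma Tri_tame:
  fixes \<phi> :: "'a::idom poly poly \<Rightarrow> 'a poly poly"
  assumes "\<phi> \<in> Tri" shows "\<phi> \<in> tame"
proof -
  have aut: "R_aut \<phi>" using assms by (auto simp: Tri_def)
  note h = R_hom_simps[OF R_aut_hom[OF aut]]
  obtain a b where ab: "\<phi> X1 = cnst a + cnst b * X1" using assms by (rule Tri_X1)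
  have "inv \<phi> \<in> Tri" using assms by (rule Tri_inv)
  then obtain a' b' where ab': "inv \<phi> X1 = cnst a' + cnst b' * X1" by (rule Tri_X1)
  \<comment> \<open>The two identities below make the affine substitutions for \<open>\<phi>\<close>
    and \<open>inv \<phi>\<close> mutually inverse, which supplies the invertibility of
    \<open>g\<close>.\<close>
  have "\<phi> (inv \<phi> X1) = X1" by (simp add: R_aut_inv_cancel[OF aut])
  then have 1: "cnst a' + cnst b' * (cnst a + cnst b * X1) = X1" by (simp add: ab' h ab)
  have "inv \<phi> (\<phi> X1) = X1" by (simp add: R_aut_inv_cancel[OF aut])
  then have 2: "cnst a + cnst b * (cnst a' + cnst b' * X1) = X1"
    by (simp add: ab' R_hom_simps[OF R_aut_hom[OF R_aut_inv[OF aut]]] ab)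
  define g where "g = eval2 (cnst a + cnst b * X1) X2"
  define g' where "g' = eval2 (cnst a' + cnst b' * X1) X2"
  have hom: "R_hom g" "R_hom g'" by (simp_all add: g_def g'_def R_hom_eval2)
  have gX: "g X1 = cnst a + cnst b * X1" "g X2 = X2" "g' X1 = cnst a' + cnst b' * X1" "g' X2 = X2"
    by (simp_all add: g_def g'_def)
  have g: "R_aut g"
  proof (rule R_autI_inverse[OF hom])
    show "g \<circ> g' = id" using 1 by (intro R_hom_eqI R_hom_comp R_hom_id hom)
        (simp_all add: R_hom_simps[OF hom(1)] gX)
    show "g' \<circ> g = id" using 2 by (intro R_hom_eqI R_hom_comp R_hom_id hom)
        (simp_all add: R_hom_simps[OF hom(2)] gX)
  qed
  moreover have "g X1 \<in> lin" using linI[of a b 0] by (simp add: gX)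
  ultimately have "g \<in> Aff" by (simp add: Aff_def gX lin_mem)
  have "(inv g \<circ> \<phi>) X1 = X1"
    using R_aut_inv_cancel(2)[OF g, of X1] by (simp add: ab gX)
  moreover have "R_aut (inv g \<circ> \<phi>)" by (intro R_aut_comp R_aut_inv g aut)
  ultimately have "elementary_aut (inv g \<circ> \<phi>)" by (simp add: elementary_aut_def)
  then have "g \<circ> (inv g \<circ> \<phi>) \<in> tame" using \<open>g \<in> Aff\<close> by (intro tame.comp Aff_tame tame.gen disjI2)
  then show ?thesis by (simp add: R_aut_inv_cancel[OF g] flip: comp_assoc)
qed

abbreviation gens :: "('a::comm_ring_1 poly poly \<Rightarrow> 'a poly poly) set" where
  "gens \<equiv> Aff \<union> Tri"

definition word :: "('b \<Rightarrow> 'b) list \<Rightarrow> 'b \<Rightarrow> 'b" where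
  "word xs = foldr (\<circ>) xs id"

lemma word_simps [simp]: "word [] = id" "word (x # xs) = x \<circ> word xs"
  by (simp_all add: word_def)

lemma word_append: "word (xs @ ys) = word xs \<circ> word ys"
  by (induction xs) (simp_all add: comp_assoc)

lemma gens_R_aut: "\<phi> \<in> gens \<Longrightarrow> R_aut \<phi>"
  by (auto simp: Aff_def Tri_def)

lemma gens_tame: "\<phi> \<in> gens \<Longrightarrow> (\<phi> :: 'a::idom poly poly \<Rightarrow> _) \<in> tame"
  using Aff_tame Tri_tame by blast

lemma word_R_aut: "set xs \<subseteq> gens \<Longrightarrow> R_aut (word xs)"
proof (induction xs)
  case (Cons x xs)
  then have "R_aut x" "R_aut (word xs)" by (simp_all add: gens_R_aut)
  then show ?case unfolding word_simps by (rule R_aut_comp)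
qed (simp add: R_aut_id)

lemma id_Aff: "id \<in> Aff"
  by (simp add: Aff_def R_aut_id lin_mem)

text \<open>Both kinds of letters are closed under inversion, so inverses of words are
  words.\<close>

lemma tame_imp_word:
  fixes \<phi> :: "'a::idom poly poly \<Rightarrow> 'a poly poly"
  assumes "\<phi> \<in> tame" obtains xs where "set xs \<subseteq> gens" "\<phi> = word xs"
proof -
  define s :: "'a poly poly \<Rightarrow> 'a poly poly" where "s = eval2 X2 X1"
  have sh: "R_hom s" and sX: "s X1 = X2" "s X2 = X1" by (simp_all add: s_def R_hom_eval2)
  have ss: "s \<circ> s = id" by (intro R_hom_eqI R_hom_comp R_hom_id sh) (simp_all add: sX)
  then have sa: "R_aut s" using sh by (blast intro: R_autI_inverse)
  then have s: "s \<in> Aff" by (simp add: Aff_def sX lin_mem)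
  have "\<exists>xs. set xs \<subseteq> gens \<and> \<phi> = word xs"
    using assms
  proof induction
    case (gen \<phi>)
    then consider "\<phi> \<in> Aff" | "R_aut \<phi>" "\<phi> X1 = X1" | "R_aut \<phi>" "\<phi> X2 = X2"
      by (auto simp: affine_aut_def elementary_aut_def Aff_def totdeg_le_1_imp_lin)
    then show ?case
    proof cases
      case 1
      then show ?thesis by (intro exI[of _ "[\<phi>]"]) simp
    next
      case 2
      then show ?thesis by (intro exI[of _ "[\<phi>]"]) (simp add: Tri_def lin1_mem)
    next
      case 3
      \<comment> \<open>Conjugation by the swap \<open>s\<close> of the variables makes an
        automorphism fixing \<open>X2\<close> triangular.\<close>
      define t where "t = s \<circ> \<phi> \<circ> s"
      have "R_aut t" unfolding t_def by (intro R_aut_comp sa 3)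
      moreover have "t X1 = X1" by (simp add: t_def sX 3)
      ultimately have "t \<in> Tri" by (simp add: Tri_def lin1_mem)
      moreover have "\<phi> = word [s, t, s]"
        using ss by (simp add: t_def fun_eq_iff)
      ultimately show ?thesis using s by (intro exI[of _ "[s, t, s]"]) simp
    qed
  next
    case (comp \<phi> \<psi>)
    then obtain xs ys where "set xs \<subseteq> gens" "\<phi> = word xs" "set ys \<subseteq> gens" "\<psi> = word ys"
      by blast
    then show ?case by (intro exI[of _ "xs @ ys"]) (simp add: word_append)
  next
    case (inverse \<phi>)
    then obtain xs where "set xs \<subseteq> gens" "\<phi> = word xs" by blast
    moreover from this(1) have "\<exists>ys. set ys \<subseteq> gens \<and> inv (word xs) = word ys"
    proof (induction xs)
      case Nil
      show ?case by (intro exI[of _ "[]"]) simp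
    next
      case (Cons x xs)
      then obtain ys where ys: "set ys \<subseteq> gens" "inv (word xs) = word ys" by auto
      have x: "x \<in> gens" and xs: "set xs \<subseteq> gens" using Cons.prems by simp_all
      have "bij x" "bij (word xs)"
        using gens_R_aut[OF x] word_R_aut[OF xs] by (simp_all add: R_aut_iff)
      then have "inv (word (x # xs)) = word (ys @ [inv x])"
        by (simp add: o_inv_distrib ys word_append)
      moreover have "inv x \<in> gens" using x Aff_inv Tri_inv by blast
      ultimately show ?case using ys by (intro exI[of _ "ys @ [inv x]"]) (simp del: word_simps)
    qed
    ultimately show ?case by simp
  qed
  then show ?thesis using that by blast
qed

section \<open>Degree growth along alternating words\<close>

text \<open>The flag says whether the next letter is to be affine (\<open>True\<close>) or triangular (\<open>False\<close>).\<close>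

definition grown :: "bool \<Rightarrow> ('a::comm_ring_1 poly poly \<Rightarrow> 'a poly poly) \<Rightarrow> nat \<Rightarrow> bool" where
  "grown b w m \<longleftrightarrow> R_hom w \<and>
     (if b then degree (w X1) < degree (w X2) \<and> m \<le> degree (w X2)
      else degree (w X2) \<le> degree (w X1) \<and> m \<le> degree (w X1) \<and> 1 \<le> degree (w X1))"

text \<open>Letters that are both affine and triangular are excluded, since they need not raise any
  degree.\<close>

fun alternating :: "bool \<Rightarrow> ('a::comm_ring_1 poly poly \<Rightarrow> 'a poly poly) list \<Rightarrow> bool" where
  "alternating b [] \<longleftrightarrow> True"
| "alternating b (x # xs) \<longleftrightarrow> x \<in> (if b then Aff - Tri else Tri - Aff) \<and> alternating (\<not> b) xs"

lemma degree_cnst [simp]: "degree (cnst a) = 0"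
  by (simp add: cnst_def)

text \<open>A letter that is not triangular has \<open>X2\<close> with nonzero coefficient in
  \<open>x X1\<close>, and \<open>w X2\<close> strictly dominates \<open>w X1\<close>; so the large
  degree moves to the image of \<open>X1\<close>.\<close>

lemma grown_Aff:
  fixes w :: "'a::idom poly poly \<Rightarrow> 'a poly poly"
  assumes "grown True w m" "x \<in> Aff - Tri" shows "grown False (w \<circ> x) m"
proof -
  have w: "R_hom w" and d: "degree (w X1) < degree (w X2)" "m \<le> degree (w X2)"
    using assms(1) by (auto simp: grown_def)
  have x: "R_aut x" "x X1 \<in> lin" "x X2 \<in> lin" "x X1 \<notin> lin1"
    using assms(2) by (auto simp: Aff_def Tri_def)
  note h = R_hom_simps[OF w]
  obtain a b c where 1: "x X1 = cnst a + cnst b * X1 + cnst c * X2" using x(2) by (rule linE)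
  obtain a' b' c' where 2: "x X2 = cnst a' + cnst b' * X1 + cnst c' * X2" using x(3) by (rule linE)
  have "c \<noteq> 0" using x(4) 1 lin1I[of a b] by auto
  have le: "degree (cnst a + cnst b * w X1) \<le> degree (w X1)" for a b
    using degree_cnst_mult_le[of b "w X1"] by (intro degree_add_le) simp_all
  have "degree (w (x X1)) = degree (w X2)"
    unfolding 1 h using le[of a b] d \<open>c \<noteq> 0\<close>
    by (subst degree_add_eq_right) (simp_all add: cnst_mult)
  moreover have "degree (w (x X2)) \<le> degree (w X2)"
    unfolding 2 h using le[of a' b'] d degree_cnst_mult_le[of c' "w X2"]
    by (meson degree_add_le less_imp_le order_trans)
  ultimately show ?thesis
    using d R_hom_comp[OF w R_aut_hom[OF x(1)]] by (simp add: grown_def)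
qed

text \<open>A letter that is not affine sends \<open>X2\<close> to a polynomial in x1 of degree at
  least 2 plus a multiple of \<open>X2\<close>. Under \<open>w\<close> the former has at least twice
  the degree of \<open>w X1\<close>; as that degree is positive, it strictly dominates
  \<open>w X2\<close>.\<close>

lemma grown_Tri:
  fixes w :: "'a::idom poly poly \<Rightarrow> 'a poly poly"
  assumes "grown False w m" "x \<in> Tri - Aff" shows "grown True (w \<circ> x) (2 * m)"
proof -
  have w: "R_hom w"
    and d: "degree (w X2) \<le> degree (w X1)" "m \<le> degree (w X1)" "1 \<le> degree (w X1)"
    using assms(1) by (auto simp: grown_def)
  have x: "R_aut x" using assms(2) by (auto simp: Tri_def)
  note h = R_hom_simps[OF w]
  have "x \<in> Tri" using assms(2) by simp
  obtain a b where 1: "x X1 = cnst a + cnst b * X1" using \<open>x \<in> Tri\<close> by (rule Tri_X1)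
  obtain p c where 2: "x X2 = [:p:] + cnst c * X2" using \<open>x \<in> Tri\<close> by (rule Tri_X2)
  have "x X1 \<in> lin" using linI[of a b 0] by (simp add: 1)
  then have "x X2 \<notin> lin" using assms(2) x by (simp add: Aff_def)
  have "degree p \<ge> 2"
  proof (rule ccontr)
    assume "\<not> degree p \<ge> 2"
    then have "[:p:] \<in> lin" by (simp add: lin_iff_degree)
    then have "x X2 \<in> lin" unfolding 2 by (intro submod_add submod_cnst submod_lin lin_mem)
    with \<open>x X2 \<notin> lin\<close> show False ..
  qed
  then have p: "2 * degree (w X1) \<le> degree (w [:p:])"
    by (simp add: degree_hom_inner[OF w])
  have "degree (w (x X2)) = degree (w [:p:])"
    unfolding 2 h using p d degree_cnst_mult_le[of c "w X2"]
    by (intro degree_add_eq_left) simp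
  moreover have "degree (w (x X1)) \<le> degree (w X1)"
    unfolding 1 h using degree_cnst_mult_le[of b "w X1"] by (intro degree_add_le) simp_all
  ultimately show ?thesis
    using d p R_hom_comp[OF w R_aut_hom[OF x(1)]] by (simp add: grown_def)
qed

lemma grown_mono: "grown b w m \<Longrightarrow> n \<le> m \<Longrightarrow> grown b w n"
  by (auto simp: grown_def split: if_splits)

lemma grown_alternating:
  fixes w :: "'a::idom poly poly \<Rightarrow> 'a poly poly"
  assumes "grown b w m" "alternating b xs"
  shows "grown (b \<longleftrightarrow> even (length xs)) (w \<circ> word xs) m"
  using assms
proof (induction xs arbitrary: b w)
  case (Cons x xs)
  have "grown (\<not> b) (w \<circ> x) m"
  proof (cases b)
    case True
    then show ?thesis using Cons.prems grown_Aff by auto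
  next
    case False
    then have "grown True (w \<circ> x) (2 * m)" using Cons.prems grown_Tri by auto
    then show ?thesis using False by (auto intro: grown_mono)
  qed
  from Cons.IH[OF this] Cons.prems show ?case by (simp add: comp_assoc split: if_splits)
qed simp

text \<open>The first two letters double the bound, the others keep it. Even length restores the
  flag \<open>True\<close>, so the word can be appended again. The start is \<open>id\<close>: in
  x2, \<open>X1\<close> has degree 0 and \<open>X2\<close> degree 1.\<close>

lemma alternating_unbounded:
  fixes xs :: "('a::idom poly poly \<Rightarrow> 'a poly poly) list"
  assumes "alternating True xs" "even (length xs)" "xs \<noteq> []"
  shows "2 ^ k \<le> degree ((word xs ^^ k) X2)"
proof -
  obtain x y ys where xs: "xs = x # y # ys"
    using assms(2,3) by (cases xs; cases "tl xs") auto
  have step: "grown True (w \<circ> word xs) (2 * m)" if "grown True w m" for w m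
  proof -
    have "grown False (w \<circ> x) m" using that assms(1) by (intro grown_Aff) (simp_all add: xs)
    then have "grown True (w \<circ> x \<circ> y) (2 * m)" using assms(1) by (intro grown_Tri) (simp_all add: xs)
    then have "grown (True \<longleftrightarrow> even (length ys)) (w \<circ> x \<circ> y \<circ> word ys) (2 * m)"
      using assms(1) by (intro grown_alternating) (simp_all add: xs)
    then show ?thesis using assms(2) by (simp add: xs comp_assoc)
  qed
  have "grown True (word xs ^^ k) (2 ^ k)"
  proof (induction k)
    case 0
    show ?case by (simp add: grown_def R_hom_id X1_def X2_def flip: id_def)
  next
    case (Suc k)
    then show ?case using step[OF Suc] by (simp only: funpow_Suc_right power_Suc)
  qed
  then show ?thesis by (simp add: grown_def)
qed

lemma alternating_append:
  "alternating b (xs @ ys) \<longleftrightarrow> alternating b xs \<and> alternating (b \<longleftrightarrow> even (length xs)) ys"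
  by (induction xs arbitrary: b) auto

text \<open>Adjacent letters of a common kind compose to a single letter. If no neighbours share a
  kind, each letter is of exactly one kind.\<close>

lemma alternating_or_shorter:
  assumes "set xs \<subseteq> gens" "length xs \<ge> 2"
  shows "(\<exists>b. alternating b xs) \<or>
    (\<exists>ys. set ys \<subseteq> gens \<and> word ys = word xs \<and> length ys < length xs)"
  using assms
proof (induction xs)
  case (Cons x xs)
  then obtain y ys where xs: "xs = y # ys" by (cases xs) auto
  have x: "x \<in> gens" and y: "y \<in> gens" and ys: "set ys \<subseteq> gens" using Cons.prems xs by auto
  show ?case
  proof (cases "x \<in> Aff \<and> y \<in> Aff \<or> x \<in> Tri \<and> y \<in> Tri")
    case True
    then have "x \<circ> y \<in> gens" using Aff_comp Tri_comp by blast
    then have "set ((x \<circ> y) # ys) \<subseteq> gens \<and> word ((x \<circ> y) # ys) = word (x # xs)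
        \<and> length ((x \<circ> y) # ys) < length (x # xs)"
      using ys by (simp add: xs comp_assoc)
    then show ?thesis by blast
  next
    case xy: False
    show ?thesis
    proof (cases "ys = []")
      case True
      have "alternating (x \<in> Aff) (x # xs)" using x y xy by (auto simp: xs True)
      then show ?thesis by blast
    next
      case False
      then have "length xs \<ge> 2" by (cases ys) (simp_all add: xs)
      then consider b where "alternating b xs"
        | zs where "set zs \<subseteq> gens" "word zs = word xs" "length zs < length xs"
        using Cons by auto
      then show ?thesis
      proof cases
        case 1
        then have "alternating (\<not> b) (x # xs)"
          using x xy by (cases b) (auto simp: xs)
        then show ?thesis by blast
      next
        case 2
        then have "set (x # zs) \<subseteq> gens \<and> word (x # zs) = word (x # xs)
            \<and> length (x # zs) < length (x # xs)"
          using x by simp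
        then show ?thesis by blast
      qed
    qed
  qed
qed simp

section \<open>Reduction to short words\<close>

context Q_domain
begin

text \<open>Quantifying over \<open>D\<close> and \<open>f\<close> makes the claim a property of
  \<open>F\<close> alone, so that \<open>F\<close> may be replaced by conjugates, with
  \<open>D\<close> and \<open>f\<close> transported along.\<close>

definition tame_descends :: "('a poly poly \<Rightarrow> 'a poly poly) \<Rightarrow> bool" where
  "tame_descends F \<longleftrightarrow> (\<forall>D f. is_LND D \<longrightarrow> D f = 0 \<longrightarrow> f \<noteq> 0
     \<longrightarrow> lnd_exp (\<lambda>p. f * D p) = F \<longrightarrow> lnd_exp D \<in> tame)"

lemma tame_descends_gens:
  assumes "F \<in> gens" shows "tame_descends F"
  unfolding tame_descends_def
proof (intro allI impI)
  fix D :: "'a poly poly \<Rightarrow> 'a poly poly" and f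
  assume LND: "is_LND D" and f: "D f = 0" "f \<noteq> 0" and F: "lnd_exp (\<lambda>p. f * D p) = F"
  have D: "R_derivation D" using LND by (simp add: is_LND_def)
  have E: "is_LND (\<lambda>p. f * D p)" by (rule is_LND_mult[OF LND f(1)])
  have aut: "R_aut F" "R_aut (lnd_exp D)" using assms gens_R_aut R_aut_lnd_exp[OF LND] by auto
  note hom = aut[THEN R_aut_hom]
  from assms have "lnd_exp D \<in> gens"
  proof
    assume "F \<in> Aff"
    then have "F p \<in> lin" if "p \<in> lin" for p
      using that hom_lin[OF hom(1)] by (auto simp: Aff_def)
    \<comment> \<open>The first iterate of the logarithm lemma gives stability under fD; cancelling
      \<open>f\<close> gives it for \<open>D\<close>.\<close>
    then have "f * D p \<in> lin" if "p \<in> lin" for p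
      using iterate_closed_if_lnd_exp_closed[OF E submod_lin _ that, of 1] by (simp add: F)
    then have "D p \<in> lin" if "p \<in> lin" for p using that lin_factor f(2) by blast
    then have "lnd_exp D p \<in> lin" if "p \<in> lin" for p
      using that lnd_exp_closed[OF LND submod_lin] by blast
    then show ?thesis using aut by (simp add: Aff_def lin_mem)
  next
    assume "F \<in> Tri"
    then have "F p \<in> lin1" if "p \<in> lin1" for p
      using that hom_lin1[OF hom(1)] by (auto simp: Tri_def)
    then have "f * D p \<in> lin1" if "p \<in> lin1" for p
      using iterate_closed_if_lnd_exp_closed[OF E submod_lin1 _ that, of 1] by (simp add: F)
    then have "D p \<in> lin1" if "p \<in> lin1" for p using that lin1_factor f(2) by blast
    then have "lnd_exp D p \<in> lin1" if "p \<in> lin1" for p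
      using that lnd_exp_closed[OF LND submod_lin1] by blast
    then show ?thesis using aut by (simp add: Tri_def lin1_mem)
  qed
  then show "lnd_exp D \<in> tame" by (rule gens_tame)
qed

lemma tame_descends_conj:
  assumes g: "R_aut g" "g \<in> tame" and "tame_descends (inv g \<circ> F \<circ> g)"
  shows "tame_descends F"
  unfolding tame_descends_def
proof (intro allI impI)
  fix D :: "'a poly poly \<Rightarrow> 'a poly poly" and f
  assume LND: "is_LND D" and f: "D f = 0" "f \<noteq> 0" and F: "lnd_exp (\<lambda>p. f * D p) = F"
  note g' = R_aut_inv[OF g(1)]
  note h = R_hom_simps[OF R_aut_hom[OF g']]
  have ii: "inv (inv g) = g" using g(1) by (simp add: R_aut_iff inv_inv_eq)
  define D' where "D' = inv g \<circ> D \<circ> g"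
  have "is_LND D'" using is_LND_conj[OF g' LND] by (simp add: D'_def ii)
  moreover have "D' (inv g f) = 0" by (simp add: D'_def R_aut_inv_cancel[OF g(1)] f h)
  moreover have "inv g f \<noteq> 0" by (simp add: R_aut_eq_0_iff[OF g'] f)
  moreover have "(\<lambda>p. inv g f * D' p) = inv g \<circ> (\<lambda>p. f * D p) \<circ> g"
    by (simp add: fun_eq_iff D'_def h)
  then have "lnd_exp (\<lambda>p. inv g f * D' p) = inv g \<circ> F \<circ> g"
    using lnd_exp_conj[OF g', of "\<lambda>p. f * D p"] by (simp add: ii F)
  ultimately have "lnd_exp D' \<in> tame" using assms(3) unfolding tame_descends_def by blast
  moreover have "lnd_exp D' = inv g \<circ> lnd_exp D \<circ> g"
    using lnd_exp_conj[OF g', of D] by (simp add: ii D'_def)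
  ultimately have "g \<circ> (inv g \<circ> lnd_exp D \<circ> g) \<circ> inv g \<in> tame"
    using g(2) by (auto intro: tame.comp tame.inverse)
  moreover have "g \<circ> (inv g \<circ> lnd_exp D \<circ> g) \<circ> inv g = lnd_exp D"
    by (simp add: fun_eq_iff R_aut_inv_cancel[OF g(1)])
  ultimately show "lnd_exp D \<in> tame" by simp
qed

text \<open>Holds vacuously: iterates of an exponential have bounded degree, those of such a word do
  not.\<close>

lemma tame_descends_even_alternating:
  assumes "alternating True xs" "even (length xs)" "xs \<noteq> []"
  shows "tame_descends (word xs)"
  unfolding tame_descends_def
proof (intro allI impI)
  fix D :: "'a poly poly \<Rightarrow> 'a poly poly" and f
  assume "is_LND D" "D f = 0" and F: "lnd_exp (\<lambda>p. f * D p) = word xs"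
  then obtain d where d: "degree ((word xs ^^ k) X2) \<le> d" for k
    using degree_lnd_exp_iterates_bounded[OF is_LND_mult] by metis
  have "2 ^ d \<le> d" using alternating_unbounded[OF assms, of d] d[of d] by (rule order_trans)
  then show "lnd_exp D \<in> tame" using less_exp[of d] by simp
qed

text \<open>Induction on length. A word that does not alternate is shortened; an alternating one of
  odd length is shortened cyclically, and one of even length is no exponential of the required
  form.\<close>

lemma tame_descends_word:
  "set xs \<subseteq> gens \<Longrightarrow> tame_descends (word xs)"
proof (induction "length xs" arbitrary: xs rule: less_induct)
  case less
  show ?case
  proof (cases "length xs \<ge> 2")
    case False
    then consider "xs = []" | x where "xs = [x]"
      by (cases xs; cases "tl xs") auto
    then show ?thesis using less.prems by cases (auto intro!: tame_descends_gens simp: id_Aff)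
  next
    case True
    then obtain x y ys where xs: "xs = x # y # ys" by (cases xs; cases "tl xs") auto
    have x: "x \<in> gens" using less.prems by (simp add: xs)
    \<comment> \<open>Conjugation by the first letter moves it to the end of the word.\<close>
    have "inv x \<circ> word xs \<circ> x = word (y # ys @ [x])"
      using R_aut_inv_cancel[OF gens_R_aut[OF x]] by (simp add: xs word_append fun_eq_iff)
    then have rotate: "tame_descends (word xs)" if "tame_descends (word (y # ys @ [x]))"
      using tame_descends_conj[OF gens_R_aut[OF x] gens_tame[OF x]] that by simp
    from alternating_or_shorter[OF less.prems True]
    consider b where "alternating b xs"
      | ys where "set ys \<subseteq> gens" "word ys = word xs" "length ys < length xs" by blast
    then show ?thesis
    proof cases
      case alt: 1
      show ?thesis
      proof (cases "even (length xs)")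
        case even: True
        show ?thesis
        proof (cases b)
          case True
          then show ?thesis using alt even by (intro tame_descends_even_alternating) (auto simp: xs)
        next
          case False
          \<comment> \<open>The word starts with a triangular letter; one rotation makes it start
            with an affine one.\<close>
          show ?thesis
            by (rule rotate, rule tame_descends_even_alternating)
              (use alt even False in \<open>auto simp: xs alternating_append\<close>)
        qed
      next
        case False
        then obtain zs z where ys: "ys = zs @ [z]" by (cases ys rule: rev_cases) (auto simp: xs)
        \<comment> \<open>In odd length the first and last letters are of the same kind, so after
          rotation they merge and the word gets shorter.\<close>
        have "x \<in> Aff \<and> z \<in> Aff \<or> x \<in> Tri \<and> z \<in> Tri"
          using alt False by (cases b) (auto simp: xs ys alternating_append)
        then have "z \<circ> x \<in> gens" using Aff_comp Tri_comp by blast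
        then have "tame_descends (word (y # zs @ [z \<circ> x]))"
          using less.prems by (intro less.hyps) (auto simp: xs ys)
        then show ?thesis by (intro rotate) (simp add: ys word_append comp_assoc)
      qed
    next
      case 2
      then show ?thesis using less.hyps by metis
    qed
  qed
qed

end

theorem theorem3p1p2:
  fixes D :: "'a::idom poly poly \<Rightarrow> 'a poly poly" and f :: "'a poly poly"
  assumes Qdomain: "\<And>n::nat. n > 0 \<Longrightarrow> (of_nat n :: 'a) dvd 1"
    and LND: "is_LND D"
    and ker: "D f = 0" and nz: "f \<noteq> 0"
    and tame_fD: "lnd_exp (\<lambda>p. f * D p) \<in> tame"
  shows "lnd_exp D \<in> tame"
proof -
  interpret Q_domain "TYPE('a)" by unfold_locales (rule Qdomain)
  obtain xs where "set xs \<subseteq> gens" "lnd_exp (\<lambda>p. f * D p) = word xs"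
    using tame_fD by (rule tame_imp_word)
  then show ?thesis using tame_descends_word[of xs] LND ker nz
    unfolding tame_descends_def by blast
qed

end
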